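(* Consider i.i.d. observations $\mathbf{X}_1,\mathbf{X}_2,\dots$ from the linear factor model described in the context, and let $(u_n)$ be a sequence of positive numbers with $n^{-1/\alpha}u_n\to0$ and $n^{-(\alpha+2)/(\alpha(\alpha+3))}u_n\to\infty$ as $n\to\infty$. Let $(k_n)$ be a sequence of positive integers with $k_n=o(nu_n^{-\alpha})$ as $n\to\infty$. Then there is a sequence of events $(B_{n,1})$ with $\mathbb{P}(B_{n,1})\to1$ as $n\to\infty$ such that, for all $n$ large enough, on the event $B_{n,1}$ the following holds: for all signed factor indices $(j_1,s_1),(j_2,s_2)$ with $s_1\mathbf{c}_{j_1}\ne s_2\mathbf{c}_{j_2}$, and all $i_1\in\mathcal{I}_n^{(j_1,s_1)}$, $i_2\in\mathcal{I}_n^{(j_2,s_2)}$, the points $\mathbf{X}_{i_1}/\|\mathbf{X}_{i_1}\|$ and $\mathbf{X}_{i_2}/\|\mathbf{X}_{i_2}\|$ belong to two different connected components of the extremal $k_n$-nearest neighbor graph. This holds for both undirected versions (ordinary and mutual) of the graph.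
   Context: Linear factor model: $A=[a_{ij}]$ is a deterministic $d\times p$ matrix with nonnegative entries and nonzero columns $\mathbf{a}^{(1)},\dots,\mathbf{a}^{(p)}$; $Z_{ij}$ ($i\ge1$, $j=1,\dots,p$) are i.i.d., either nonnegative ("nonnegative case") or symmetric ("symmetric case"), with $\mathbb{P}(Z_{11}>z)\sim cz^{-\alpha}$ as $z\to\infty$ for some $\alpha>0$, $c>0$; $\mathbf{X}_i=A(Z_{i1},\dots,Z_{ip})^\top$. Norms are Euclidean. $\mathbf{c}_j=\mathbf{a}^{(j)}/\|\mathbf{a}^{(j)}\|$ and $a^*=d^{1/2}\max_{m,j}a_{mj}$. Extremes: $\mathcal{I}_n=\{i\le n:\|\mathbf{X}_i\|>u_n\}$. A signed factor index is a pair $(j,s)$ with $j\in\{1,\dots,p\}$ and $s=+1$ in the nonnegative case, $s\in\{+1,-1\}$ in the symmetric case; $\mathcal{I}_n^{(j,s)}=\{i\le n:\ \|\mathbf{X}_i\|>u_n,\ sZ_{ij}>u_n/a^*\}$ is the set of extremes generated by factor $j$ with sign $s$. Extremal $k$-nearest neighbor graph: the vertex set is $\mathcal{I}_n$, vertex $i$ being identified with the point $\mathbf{X}_i/\|\mathbf{X}_i\|$ on the unit sphere. For $i\ne i'$ in $\mathcal{I}_n$, $i'$ is among the $k$-nearest neighbors of $i$ if fewer than $k$ vertices $l\neq i$ have their point strictly closer (in Euclidean distance) to the point of $i$ than the point of $i'$ is. In the ordinary undirected $k$-NN graph, $i,i'$ are joined by an edge if at least one of them is among the $k$-nearest neighbors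 of the other; in the mutual $k$-NN graph, if each is among the $k$-nearest neighbors of the other. *)

theory Defs
  imports "HOL-Probability.Probability" "HOL-Library.Landau_Symbols"
begin

definition obs :: "real ^ 'p ^ 'd \<Rightarrow> (nat \<Rightarrow> 'p::finite \<Rightarrow> 'w \<Rightarrow> real) \<Rightarrow> nat \<Rightarrow> 'w \<Rightarrow> real ^ 'd" where
  "obs A Z i \<omega> = A *v (\<chi> j. Z i j \<omega>)"

definition sphere_point ::
    "real ^ 'p ^ 'd \<Rightarrow> (nat \<Rightarrow> 'p::finite \<Rightarrow> 'w \<Rightarrow> real) \<Rightarrow> 'w \<Rightarrow> nat \<Rightarrow> real ^ 'd" where
  "sphere_point A Z \<omega> i = obs A Z i \<omega> /\<^sub>R norm (obs A Z i \<omega>)"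

definition cdir :: "real ^ 'p ^ 'd \<Rightarrow> 'p \<Rightarrow> real ^ 'd" where
  "cdir A j = column j A /\<^sub>R norm (column j A)"

definition astar :: "real ^ 'p::finite ^ 'd::finite \<Rightarrow> real" where
  "astar A = sqrt (real CARD('d)) * Max (range (\<lambda>(m, j). A $ m $ j))"

definition extremes ::
    "real ^ 'p ^ 'd \<Rightarrow> (nat \<Rightarrow> 'p::finite \<Rightarrow> 'w \<Rightarrow> real) \<Rightarrow> (nat \<Rightarrow> real) \<Rightarrow> nat \<Rightarrow> 'w \<Rightarrow> nat set" where
  "extremes A Z u n \<omega> = {i \<in> {1..n}. norm (obs A Z i \<omega>) > u n}"

definition factor_extremes ::
    "real ^ 'p ^ 'd \<Rightarrow> (nat \<Rightarrow> 'p::finite \<Rightarrow> 'w \<Rightarrow> real) \<Rightarrow> (nat \<Rightarrow> real) \<Rightarrow> nat \<Rightarrow> 'p \<Rightarrow> real \<Rightarrow> 'w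
      \<Rightarrow> nat set" where
  "factor_extremes A Z u n j s \<omega> =
     {i \<in> {1..n}. norm (obs A Z i \<omega>) > u n \<and> s * Z i j \<omega> > u n / astar A}"

(* The vertices are the elements of V; vertex i carries the point f i.  Distinct vertices
   may carry the same point, and ties in distance may give a vertex more than k nearest
   neighbors. *)
definition is_knn :: "nat \<Rightarrow> 'v set \<Rightarrow> ('v \<Rightarrow> 'x::metric_space) \<Rightarrow> 'v \<Rightarrow> 'v \<Rightarrow> bool" where
  "is_knn k V f i i' \<longleftrightarrow> i \<in> V \<and> i' \<in> V \<and> i \<noteq> i' \<and>
     card {l \<in> V. l \<noteq> i \<and> dist (f l) (f i) < dist (f i') (f i)} < k"

definition knn_edges :: "nat \<Rightarrow> 'v set \<Rightarrow> ('v \<Rightarrow> 'x::metric_space) \<Rightarrow> ('v \<times> 'v) set" where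
  "knn_edges k V f = {(i, i'). is_knn k V f i i' \<or> is_knn k V f i' i}"

definition mutual_knn_edges :: "nat \<Rightarrow> 'v set \<Rightarrow> ('v \<Rightarrow> 'x::metric_space) \<Rightarrow> ('v \<times> 'v) set" where
  "mutual_knn_edges k V f = {(i, i'). is_knn k V f i i' \<and> is_knn k V f i' i}"

(* Vertex sets of the connected components of the undirected graph with vertex set V, whose
   edges are given by a symmetric relation E contained in V \<times> V: the classes of the
   relation "joined by a path".  Isolated vertices form singleton components. *)
definition components_of_graph :: "'v set \<Rightarrow> ('v \<times> 'v) set \<Rightarrow> 'v set set" where
  "components_of_graph V E = V // (E\<^sup>* \<inter> V \<times> V)"

definition in_different_components :: "'v set \<Rightarrow> ('v \<times> 'v) set \<Rightarrow> 'v \<Rightarrow> 'v \<Rightarrow> bool" where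
  "in_different_components V E v w \<longleftrightarrow>
     (\<exists>C \<in> components_of_graph V E. \<exists>D \<in> components_of_graph V E. v \<in> C \<and> w \<in> D \<and> C \<noteq> D)"

end

theory Submission
  imports Defs "HOL-Real_Asymp.Real_Asymp"
begin

text \<open>
The lower bound on \<open>u\<close> gives \<open>n u\<^sub>n\<^sup>-\<^sup>2\<^sup>\<alpha> \<rightarrow> 0\<close>, so for every fixed \<open>\<epsilon> > 0\<close>, with
probability tending to one, no observation has two factors exceeding \<open>\<epsilon> u\<^sub>n\<close> in absolute
value. An extreme observation is then dominated by a single factor, and its point on the sphere
lies within \<open>O(\<epsilon>)\<close> of some \<open>s c\<^sub>j\<close>. Since these directions are finitely many, a small
\<open>\<epsilon>\<close> makes the points cluster so tightly around them that two points of one cluster are always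
closer than two points of different clusters. On the other hand, every cluster contains the
observations with \<open>s Z\<^sub>i\<^sub>j > K u\<^sub>n\<close> for a suitable constant \<open>K\<close>; their number is binomial with
mean of order \<open>n u\<^sub>n\<^sup>-\<^sup>\<alpha> \<rightarrow> \<infinity>\<close>, hence exceeds \<open>k\<^sub>n\<close> with probability tending to one.
So all \<open>k\<^sub>n\<close> nearest neighbors of a point lie in its own cluster, and no edge joins two
clusters.
\<close>

subsection \<open>Clusters in nearest neighbor graphs\<close>

lemma not_rtrancl_if_label_preserved:
  assumes "\<And>x y. (x, y) \<in> E \<Longrightarrow> g x = g y" and "g v \<noteq> g w"
  shows "(v, w) \<notin> E\<^sup>*"
proof
  assume "(v, w) \<in> E\<^sup>*"
  then have "g v = g w"
    by (induction rule: rtrancl_induct) (use assms(1) in auto)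
  with assms(2) show False by simp
qed

text \<open>A label that agrees along every edge is constant along paths, so \<open>w\<close> lies
  outside the class of \<open>v\<close> and inside its own. The two classes differ in the element
  \<open>w\<close>.\<close>

lemma in_different_componentsI:
  assumes "v \<in> V" "w \<in> V" and "\<And>x y. (x, y) \<in> E \<Longrightarrow> g x = g y" and "g v \<noteq> g w"
  shows "in_different_components V E v w"
proof -
  let ?R = "E\<^sup>* \<inter> V \<times> V"
  have "w \<notin> ?R `` {v}" "w \<in> ?R `` {w}" "v \<in> ?R `` {v}"
    using not_rtrancl_if_label_preserved[OF assms(3,4)] assms(1,2) by auto
  moreover have "?R `` {v} \<in> V // ?R" "?R `` {w} \<in> V // ?R"
    using assms(1,2) by (auto intro: quotientI)
  ultimately show ?thesis
    unfolding in_different_components_def components_of_graph_def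
    by (intro bexI[of _ "?R `` {v}"] bexI[of _ "?R `` {w}"]) auto
qed

text \<open>Counting argument: if \<open>i'\<close> carried another label, every other vertex with
  the label of \<open>i\<close> would be strictly closer to \<open>i\<close> than \<open>i'\<close>
  is. There are at least \<open>k\<close> of them, while \<open>is_knn\<close> allows fewer than
  \<open>k\<close>.\<close>

lemma is_knn_same_label:
  fixes f :: "'v \<Rightarrow> 'x::metric_space"
  assumes "finite V" and "is_knn k V f i i'"
    and large: "k < card {l \<in> V. g l = g i}"
    and closer: "\<And>l. l \<in> V \<Longrightarrow> g l = g i \<Longrightarrow> g i' \<noteq> g i \<Longrightarrow> dist (f l) (f i) < dist (f i') (f i)"
  shows "g i = g i'"
proof (rule ccontr)
  assume ne: "g i \<noteq> g i'"
  let ?C = "{l \<in> V. g l = g i}" and ?N = "{l \<in> V. l \<noteq> i \<and> dist (f l) (f i) < dist (f i') (f i)}"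
  have "?C - {i} \<subseteq> ?N"
    using closer ne by auto
  then have "card (?C - {i}) \<le> card ?N"
    using assms(1) by (intro card_mono) auto
  \<comment> \<open>The strict inequality in \<open>large\<close> compensates for removing
    \<open>i\<close>, which does not count as its own neighbor.\<close>
  moreover have "k \<le> card (?C - {i})"
    using large by (auto simp: card_Diff_singleton_if)
  moreover have "card ?N < k"
    using assms(2) by (simp add: is_knn_def)
  ultimately show False by simp
qed

text \<open>The function \<open>g\<close> serves both as label and as cluster center. Points with
  the same center are at most 2 \<delta> apart, whereas points with different centers are more than
  4 \<delta> - 2 \<delta> apart, so a nearest neighbor never leaves the cluster.\<close>

lemma in_different_components_knn:
  fixes f :: "'v \<Rightarrow> 'x::metric_space"
  assumes "finite V" "v \<in> V" "w \<in> V" "g v \<noteq> g w"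
    and near: "\<And>i. i \<in> V \<Longrightarrow> dist (f i) (g i) \<le> \<delta>"
    and apart: "\<And>i i'. i \<in> V \<Longrightarrow> i' \<in> V \<Longrightarrow> g i \<noteq> g i' \<Longrightarrow> 4 * \<delta> < dist (g i) (g i')"
    and large: "\<And>i. i \<in> V \<Longrightarrow> k < card {l \<in> V. g l = g i}"
  shows "in_different_components V (knn_edges k V f) v w"
    and "in_different_components V (mutual_knn_edges k V f) v w"
proof -
  have closer: "dist (f l) (f i) < dist (f i') (f i)"
    if "i \<in> V" "i' \<in> V" "l \<in> V" "g l = g i" "g i' \<noteq> g i" for i i' l
  proof -
    have "dist (f l) (f i) \<le> 2 * \<delta>"
      using dist_triangle2[of "f l" "f i" "g i"] near[of l] near[of i] that by simp
    moreover have "dist (g i) (g i') \<le> dist (f i) (g i) + dist (f i') (f i) + dist (f i') (g i')"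
      using dist_triangle[of "g i" "g i'" "f i"] dist_triangle[of "f i" "g i'" "f i'"]
      by (simp add: dist_commute)
    ultimately show ?thesis
      using near[of i] near[of i'] apart[of i i'] that by auto
  qed
  have same: "g i = g i'" if "is_knn k V f i i'" for i i'
  proof (rule is_knn_same_label[OF assms(1) that])
    show "k < card {l \<in> V. g l = g i}"
      using that large by (simp add: is_knn_def)
  qed (use that closer in \<open>auto simp: is_knn_def\<close>)
  \<comment> \<open>One direction of the nearest neighbor relation already forces equal labels, so
    the disjunction in \<open>knn_edges\<close> and the conjunction in
    \<open>mutual_knn_edges\<close> are covered alike.\<close>
  show "in_different_components V (knn_edges k V f) v w"
    by (rule in_different_componentsI[where g = g, OF assms(2,3) _ assms(4)])
      (auto simp: knn_edges_def dest: same)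
  show "in_different_components V (mutual_knn_edges k V f) v w"
    by (rule in_different_componentsI[where g = g, OF assms(2,3) _ assms(4)])
      (auto simp: mutual_knn_edges_def dest: same)
qed

section \<open>Geometry of the linear factor model\<close>

lemma dist_normalized_le:
  fixes x y :: "'a::real_normed_vector"
  assumes "x \<noteq> 0" "y \<noteq> 0"
  shows "dist (x /\<^sub>R norm x) (y /\<^sub>R norm y) \<le> 2 * norm (x - y) / norm x"
proof -
  \<comment> \<open>Scaling by \<open>norm x\<close> splits the difference of the unit vectors into
    \<open>x - y\<close> and a multiple of \<open>y\<close> whose norm is the difference of the two
    norms. Each part is at most \<open>norm (x - y)\<close>, whence the factor 2.\<close>
  have "norm x *\<^sub>R (x /\<^sub>R norm x - y /\<^sub>R norm y) = (x - y) + ((norm y - norm x) / norm y) *\<^sub>R y"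
    using assms by (simp add: algebra_simps diff_divide_distrib divide_inverse)
  then have "norm x * dist (x /\<^sub>R norm x) (y /\<^sub>R norm y)
      = norm ((x - y) + ((norm y - norm x) / norm y) *\<^sub>R y)"
    by (metis abs_norm_cancel dist_norm norm_scaleR)
  also have "\<dots> \<le> norm (x - y) + \<bar>norm y - norm x\<bar>"
    using assms by (intro order_trans[OF norm_triangle_ineq]) simp
  also have "\<dots> \<le> 2 * norm (x - y)"
    using norm_triangle_ineq3[of y x] by (simp add: norm_minus_commute)
  finally show ?thesis
    using assms by (simp add: field_simps)
qed

text \<open>Only the columns other than \<open>j\<close> survive the subtraction. The bound extends
  the sum to all columns so that one constant serves every \<open>j\<close>.\<close>

lemma norm_matrix_vector_minus_column_le:
  fixes A :: "real ^ 'p::finite ^ 'd::finite" and z :: "real ^ 'p"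
  assumes "0 \<le> r" and "\<And>j'. j' \<noteq> j \<Longrightarrow> \<bar>z $ j'\<bar> \<le> r"
  shows "norm (A *v z - z $ j *\<^sub>R column j A) \<le> r * (\<Sum>j'\<in>UNIV. norm (column j' A))"
proof -
  have "A *v z - z $ j *\<^sub>R column j A = (\<Sum>j'\<in>UNIV - {j}. z $ j' *\<^sub>R column j' A)"
    by (simp add: matrix_mult_sum scalar_mult_eq_scaleR sum.remove[of UNIV j])
  also have "norm \<dots> \<le> (\<Sum>j'\<in>UNIV - {j}. r * norm (column j' A))"
    using assms(2) by (intro order_trans[OF norm_sum] sum_mono) (auto intro!: mult_right_mono)
  also have "\<dots> \<le> (\<Sum>j'\<in>UNIV. r * norm (column j' A))"
    using assms(1) by (intro sum_mono2) auto
  finally show ?thesis by (simp add: sum_distrib_left)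
qed

lemma norm_matrix_vector_le:
  fixes A :: "real ^ 'p::finite ^ 'd::finite" and z :: "real ^ 'p"
  assumes "\<And>j. \<bar>z $ j\<bar> \<le> r"
  shows "norm (A *v z) \<le> r * (\<Sum>j\<in>UNIV. norm (column j A))"
  unfolding matrix_mult_sum scalar_mult_eq_scaleR sum_distrib_left
  using assms by (intro order_trans[OF norm_sum] sum_mono) (auto intro!: mult_right_mono)

lemma astar_pos:
  fixes A :: "real ^ 'p::finite ^ 'd::finite"
  assumes nonneg: "\<And>m j. A $ m $ j \<ge> 0" and "\<And>j. column j A \<noteq> 0"
  shows "astar A > 0"
proof -
  obtain m j where "A $ m $ j \<noteq> 0"
    using assms(2) by (metis column_def vec_eq_iff vec_lambda_beta zero_index)
  with nonneg[of m j] have "0 < A $ m $ j" by simp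
  also have "\<dots> \<le> Max (range (\<lambda>(m, j). A $ m $ j))"
    by (intro Max_ge) (auto intro!: image_eqI[of _ _ "(m, j)"])
  finally show ?thesis by (simp add: astar_def)
qed

text \<open>The observation is compared with \<open>Z i j \<omega> *\<^sub>R column j A\<close>,
  whose direction is exactly \<open>s *\<^sub>R cdir A j\<close> because \<open>s\<close> is the
  sign of the factor. The error is proportional to \<open>\<epsilon> * U\<close>, and normalization
  divides by a norm above \<open>U\<close>, so the threshold cancels.\<close>

lemma dist_sphere_point_cdir_le:
  assumes "0 < U" "U < norm (obs A Z i \<omega>)" "0 \<le> \<epsilon>"
    and s: "\<bar>s\<bar> = 1" and dom: "0 < s * Z i j \<omega>" and col: "column j A \<noteq> 0"
    and rest: "\<And>j'. j' \<noteq> j \<Longrightarrow> \<bar>Z i j' \<omega>\<bar> \<le> \<epsilon> * U"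
  shows "dist (sphere_point A Z \<omega> i) (s *\<^sub>R cdir A j) \<le> 2 * \<epsilon> * (\<Sum>j'\<in>UNIV. norm (column j' A))"
proof -
  let ?L = "\<Sum>j'\<in>UNIV. norm (column j' A)"
  let ?x = "obs A Z i \<omega>" and ?y = "Z i j \<omega> *\<^sub>R column j A"
  have x: "?x \<noteq> 0" using assms(1,2) by auto
  have z: "Z i j \<omega> \<noteq> 0" using dom by auto
  have sgn: "Z i j \<omega> / \<bar>Z i j \<omega>\<bar> = s"
    using dom s by (auto simp: abs_if zero_less_mult_iff split: if_splits)
  have "?y /\<^sub>R norm ?y = (Z i j \<omega> / \<bar>Z i j \<omega>\<bar>) *\<^sub>R cdir A j"
    using z by (simp add: cdir_def divide_inverse mult.commute mult.left_commute)
  then have "dist (sphere_point A Z \<omega> i) (s *\<^sub>R cdir A j) \<le> 2 * norm (?x - ?y) / norm ?x"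
    using dist_normalized_le[OF x, of ?y] z col by (simp add: sphere_point_def sgn)
  also have "\<dots> \<le> 2 * (\<epsilon> * U * ?L) / U"
  proof (intro frac_le mult_left_mono)
    show "norm (?x - ?y) \<le> \<epsilon> * U * ?L"
      unfolding obs_def
      using norm_matrix_vector_minus_column_le[of "\<epsilon> * U" j "\<chi> j. Z i j \<omega>" A] rest assms(1,3)
      by simp
  qed (use assms(1-3) in \<open>auto intro!: mult_nonneg_nonneg sum_nonneg\<close>)
  finally show ?thesis using assms(1) by simp
qed

lemma finite_separated:
  fixes W :: "'a::metric_space set"
  assumes "finite W"
  obtains D where "D > 0" "\<And>v w. v \<in> W \<Longrightarrow> w \<in> W \<Longrightarrow> v \<noteq> w \<Longrightarrow> D \<le> dist v w"
proof -
  \<comment> \<open>The inserted 1 keeps \<open>R\<close> nonempty, so that \<open>Min R\<close> is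
    meaningful even if \<open>W\<close> has at most one point.\<close>
  define R where "R = insert 1 ((\<lambda>(v, w). dist v w) ` {(v, w) \<in> W \<times> W. v \<noteq> w})"
  have fin: "finite R"
    unfolding R_def using assms by (auto intro: finite_subset[of _ "W \<times> W"])
  show ?thesis
  proof
    show "Min R > 0"
      using fin by (subst Min_gr_iff) (auto simp: R_def)
    show "Min R \<le> dist v w" if "v \<in> W" "w \<in> W" "v \<noteq> w" for v w
      using that by (intro Min_le[OF fin]) (force simp: R_def)
  qed
qed

text \<open>Deterministic core, at a fixed outcome \<omega>; \<open>single\<close>,
  \<open>sign\<close> and \<open>large\<close> describe a good outcome. The bound
  \<open>\<epsilon> * L \<le> 1\<close> gives every extreme a factor above
  \<open>\<epsilon> * u n\<close>, and \<open>\<epsilon> \<le> 1 / astar A\<close> puts the factors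
  defining \<open>factor_extremes\<close> above that level. The bounds on \<open>K\<close> make
  every observation with a factor above \<open>K * u n\<close> an extreme, and \<open>apart\<close>
  is four times the cluster radius \<open>2 * \<epsilon> * L\<close>.\<close>

lemma factor_clusters_in_different_components:
  fixes A :: "real ^ 'p::finite ^ 'd::finite"
  defines "L \<equiv> \<Sum>j\<in>UNIV. norm (column j A)"
  assumes A_columns: "\<And>j. column j A \<noteq> 0"
    and S: "S \<subseteq> {1, -1}"
    and u: "0 < u n" and \<epsilon>: "0 < \<epsilon>" "\<epsilon> * L \<le> 1" "\<epsilon> \<le> 1 / astar A"
    and K: "\<epsilon> \<le> K" "\<And>j. 2 \<le> K * norm (column j A)"
    and apart: "\<And>j s j' s'. s \<in> S \<Longrightarrow> s' \<in> S \<Longrightarrow> s *\<^sub>R cdir A j \<noteq> s' *\<^sub>R cdir A j' \<Longrightarrow>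
                  8 * \<epsilon> * L < dist (s *\<^sub>R cdir A j) (s' *\<^sub>R cdir A j')"
    and single: "\<And>i j j'. i \<in> {1..n} \<Longrightarrow> j \<noteq> j' \<Longrightarrow>
                  \<bar>Z i j \<omega>\<bar> \<le> \<epsilon> * u n \<or> \<bar>Z i j' \<omega>\<bar> \<le> \<epsilon> * u n"
    and sign: "\<And>i j. i \<in> {1..n} \<Longrightarrow> \<exists>s\<in>S. s * Z i j \<omega> = \<bar>Z i j \<omega>\<bar>"
    and large: "\<And>j s. s \<in> S \<Longrightarrow> k < card {i \<in> {1..n}. s * Z i j \<omega> > K * u n}"
    and s1: "s\<^sub>1 \<in> S" and s2: "s\<^sub>2 \<in> S" and ne: "s\<^sub>1 *\<^sub>R cdir A j\<^sub>1 \<noteq> s\<^sub>2 *\<^sub>R cdir A j\<^sub>2"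
    and i1: "i\<^sub>1 \<in> factor_extremes A Z u n j\<^sub>1 s\<^sub>1 \<omega>"
    and i2: "i\<^sub>2 \<in> factor_extremes A Z u n j\<^sub>2 s\<^sub>2 \<omega>"
  shows "in_different_components (extremes A Z u n \<omega>)
           (knn_edges k (extremes A Z u n \<omega>) (sphere_point A Z \<omega>)) i\<^sub>1 i\<^sub>2"
    and "in_different_components (extremes A Z u n \<omega>)
           (mutual_knn_edges k (extremes A Z u n \<omega>) (sphere_point A Z \<omega>)) i\<^sub>1 i\<^sub>2"
proof -
  let ?V = "extremes A Z u n \<omega>" and ?f = "sphere_point A Z \<omega>"
  have abs_s: "\<bar>s\<bar> = 1" if "s \<in> S" for s using S that by auto
  have U\<epsilon>: "0 < \<epsilon> * u n" using u \<epsilon> by simp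
  have near: "dist (?f i) (s *\<^sub>R cdir A j) \<le> 2 * \<epsilon> * L"
    if i: "i \<in> ?V" and "s \<in> S" and dom: "\<epsilon> * u n < s * Z i j \<omega>" for i s j
  proof -
    have "s * Z i j \<omega> \<le> \<bar>Z i j \<omega>\<bar>"
      using abs_s[OF \<open>s \<in> S\<close>] by (metis abs_ge_self abs_mult mult_1)
    then have rest: "\<bar>Z i j' \<omega>\<bar> \<le> \<epsilon> * u n" if "j' \<noteq> j" for j'
      using single[of i j j'] i dom that by (auto simp: extremes_def)
    show ?thesis
      unfolding L_def
      using i order.strict_trans[OF U\<epsilon> dom] \<epsilon>(1) u
      by (intro dist_sphere_point_cdir_le[of "u n"] abs_s A_columns rest \<open>s \<in> S\<close>)
        (auto simp: extremes_def)
  qed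
  have ex: "\<exists>j. \<exists>s\<in>S. \<epsilon> * u n < s * Z i j \<omega>" if i: "i \<in> ?V" for i
  proof -
    have "\<exists>j. \<epsilon> * u n < \<bar>Z i j \<omega>\<bar>"
    proof (rule ccontr)
      assume "\<not> ?thesis"
      then have "norm (obs A Z i \<omega>) \<le> \<epsilon> * u n * L"
        unfolding obs_def L_def by (intro norm_matrix_vector_le) (auto simp: not_less)
      also have "\<dots> = (\<epsilon> * L) * u n" by simp
      also have "\<dots> \<le> 1 * u n"
        using u \<epsilon>(2) by (intro mult_right_mono) auto
      finally show False using i by (simp add: extremes_def)
    qed
    with sign[of i] i show ?thesis by (metis (no_types, lifting) extremes_def mem_Collect_eq)
  qed
  \<comment> \<open>An extreme is labelled by the direction of a signed factor above
    \<open>\<epsilon> * u n\<close>. Labels are directions rather than index pairs, since parallel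
    columns share one direction and their clusters merge.\<close>
  have "\<forall>i. \<exists>v. i \<in> ?V \<longrightarrow> (\<exists>j. \<exists>s\<in>S. v = s *\<^sub>R cdir A j \<and> \<epsilon> * u n < s * Z i j \<omega>)"
    using ex by blast
  then have "\<exists>g. \<forall>i. i \<in> ?V \<longrightarrow> (\<exists>j. \<exists>s\<in>S. g i = s *\<^sub>R cdir A j \<and> \<epsilon> * u n < s * Z i j \<omega>)"
    by (rule choice)
  then obtain g where g:
    "\<And>i. i \<in> ?V \<Longrightarrow> \<exists>j. \<exists>s\<in>S. g i = s *\<^sub>R cdir A j \<and> \<epsilon> * u n < s * Z i j \<omega>"
    by blast
  have g_near: "dist (?f i) (g i) \<le> 2 * \<epsilon> * L" if "i \<in> ?V" for i
    using g[OF that] near[OF that] by metis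
  have L: "0 < L"
    unfolding L_def using A_columns by (intro sum_pos) auto
  \<comment> \<open>The choice made in \<open>g\<close> is immaterial: two admissible directions
    both lie within \<open>2 * \<epsilon> * L\<close> of the same sphere point, so they are too
    close to be distinct.\<close>
  have g_eq: "g i = s *\<^sub>R cdir A j" if i: "i \<in> ?V" and "s \<in> S" and "\<epsilon> * u n < s * Z i j \<omega>" for i s j
  proof (rule ccontr)
    assume "g i \<noteq> s *\<^sub>R cdir A j"
    then have "8 * \<epsilon> * L < dist (g i) (s *\<^sub>R cdir A j)"
      using g[OF i] apart[of _ s] \<open>s \<in> S\<close> by metis
    moreover have "dist (g i) (s *\<^sub>R cdir A j) \<le> dist (?f i) (g i) + dist (?f i) (s *\<^sub>R cdir A j)"
      by (rule dist_triangle3)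
    moreover have "0 < \<epsilon> * L" using \<epsilon> L by simp
    ultimately show False
      using g_near[OF i] near[OF that] by simp
  qed
  have factor: "i \<in> ?V \<and> g i = s *\<^sub>R cdir A j"
    if "i \<in> factor_extremes A Z u n j s \<omega>" "s \<in> S" for i j s
  proof -
    have "\<epsilon> * u n \<le> u n / astar A"
      using \<epsilon>(3) u mult_right_mono[of \<epsilon> "1 / astar A" "u n"] by simp
    with that g_eq[of i s j] show ?thesis by (auto simp: factor_extremes_def extremes_def)
  qed
  have big: "k < card {l \<in> ?V. g l = g i}" if i: "i \<in> ?V" for i
  proof -
    from g[OF i] obtain j s where js: "s \<in> S" "g i = s *\<^sub>R cdir A j" by blast
    \<comment> \<open>A factor above \<open>K * u n\<close> contributes a vector of norm greater
      than \<open>2 * u n\<close>, and the other factors change it by at most \<open>u n\<close>.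
      Hence the observation is extreme and gets the same label as \<open>i\<close>.\<close>
    have "{l \<in> {1..n}. s * Z l j \<omega> > K * u n} \<subseteq> {l \<in> ?V. g l = g i}"
    proof (intro subsetI)
      fix l assume "l \<in> {l \<in> {1..n}. s * Z l j \<omega> > K * u n}"
      then have l: "l \<in> {1..n}" and Kl: "K * u n < s * Z l j \<omega>" by auto
      have \<epsilon>l: "\<epsilon> * u n < s * Z l j \<omega>"
        using Kl K(1) u mult_right_mono[of \<epsilon> K "u n"] by linarith
      have absl: "s * Z l j \<omega> \<le> \<bar>Z l j \<omega>\<bar>"
        using abs_s[OF \<open>s \<in> S\<close>] by (metis abs_ge_self abs_mult mult_1)
      then have rest: "\<bar>Z l j' \<omega>\<bar> \<le> \<epsilon> * u n" if "j' \<noteq> j" for j'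
        using single[of l j j'] l \<epsilon>l that by auto
      have "norm (obs A Z l \<omega> - Z l j \<omega> *\<^sub>R column j A) \<le> \<epsilon> * u n * L"
        unfolding obs_def L_def
        using norm_matrix_vector_minus_column_le[of "\<epsilon> * u n" j "\<chi> j. Z l j \<omega>" A] rest U\<epsilon> by simp
      also have "\<dots> = (\<epsilon> * L) * u n" by simp
      also have "\<dots> \<le> 1 * u n"
        using u \<epsilon>(2) by (intro mult_right_mono) auto
      finally have "norm (Z l j \<omega> *\<^sub>R column j A) - u n \<le> norm (obs A Z l \<omega>)"
        using norm_triangle_ineq2[of "Z l j \<omega> *\<^sub>R column j A" "obs A Z l \<omega>"]
        by (simp add: norm_minus_commute)
      moreover have "2 * u n \<le> (K * norm (column j A)) * u n"
        using K(2)[of j] u by (intro mult_right_mono) auto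
      moreover have "(K * u n) * norm (column j A) < \<bar>Z l j \<omega>\<bar> * norm (column j A)"
        using Kl absl A_columns[of j] by (intro mult_strict_right_mono) auto
      ultimately have "u n < norm (obs A Z l \<omega>)" by (simp add: mult_ac)
      with l have "l \<in> ?V" by (simp add: extremes_def)
      with g_eq[OF this \<open>s \<in> S\<close> \<epsilon>l] js show "l \<in> {l \<in> ?V. g l = g i}" by simp
    qed
    then have "card {l \<in> {1..n}. s * Z l j \<omega> > K * u n} \<le> card {l \<in> ?V. g l = g i}"
      by (intro card_mono) (auto simp: extremes_def)
    with large[OF js(1), of j] show ?thesis by simp
  qed
  have g_apart: "4 * (2 * \<epsilon> * L) < dist (g i) (g i')" if "i \<in> ?V" "i' \<in> ?V" "g i \<noteq> g i'" for i i'
    using g[OF that(1)] g[OF that(2)] apart that(3) by fastforce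
  have fin: "finite ?V" by (simp add: extremes_def)
  have g_ne: "g i\<^sub>1 \<noteq> g i\<^sub>2" using factor[OF i1 s1] factor[OF i2 s2] ne by simp
  note c = in_different_components_knn[where g = g and f = ?f and \<delta> = "2 * \<epsilon> * L", OF fin _ _ g_ne g_near g_apart big]
  show "in_different_components ?V (knn_edges k ?V ?f) i\<^sub>1 i\<^sub>2"
    and "in_different_components ?V (mutual_knn_edges k ?V ?f) i\<^sub>1 i\<^sub>2"
    using c factor[OF i1 s1] factor[OF i2 s2] by auto
qed

subsection \<open>Probability bounds\<close>

text \<open>A Chernoff bound: Markov's inequality for \<open>2\<^sup>-\<^sup>N\<close>, where \<open>N\<close> is the number of successes.\<close>

lemma (in prob_space) prob_card_le:
  fixes Y :: "'i \<Rightarrow> 'a \<Rightarrow> real"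
  assumes "finite I" and indep: "indep_vars (\<lambda>_. borel) Y I"
    and T[measurable]: "T \<in> sets borel"
    and q: "\<And>i. i \<in> I \<Longrightarrow> prob (Y i -` T \<inter> space M) = q"
  shows "prob {\<omega> \<in> space M. card {i \<in> I. Y i \<omega> \<in> T} \<le> k} \<le> 2 ^ k * exp (- (real (card I) * q / 2))"
proof -
  \<comment> \<open>This is 2 to the power minus the success indicator, in a form linear in the
    indicator so that its expectation is immediate.\<close>
  define W where "W i \<omega> = (1 - indicator T (Y i \<omega>) / 2 :: real)" for i \<omega>
  have [measurable]: "random_variable borel (Y i)" if "i \<in> I" for i
    using indep that by (auto simp: indep_vars_def)
  have indepW: "indep_vars (\<lambda>_. borel) W I"
    unfolding W_def by (rule indep_vars_compose2[OF indep]) measurable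
  have intW: "integrable M (W i)" if "i \<in> I" for i
    unfolding W_def using that
    by (intro integrable_const_bound[where B = 1]) (auto simp: indicator_def)
  have expW: "expectation (W i) = 1 - q / 2" if "i \<in> I" for i
  proof -
    have "expectation (W i) = expectation (\<lambda>\<omega>. 1 - indicator (Y i -` T \<inter> space M) \<omega> / 2)"
      unfolding W_def by (intro Bochner_Integration.integral_cong) (auto simp: indicator_def)
    also have "\<dots> = 1 - q / 2"
    proof -
      have "integrable M (indicat_real (Y i -` T \<inter> space M))"
        using that by (intro integrable_real_indicator) (auto simp: emeasure_eq_measure)
      then show ?thesis
        using that by (subst Bochner_Integration.integral_diff) (auto simp: prob_space q)
    qed
    finally show ?thesis .
  qed
  have prodW: "(\<Prod>i\<in>I. W i \<omega>) = (1 / 2) ^ card {i \<in> I. Y i \<omega> \<in> T}" for \<omega>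
  proof -
    have "(\<Prod>i\<in>I. W i \<omega>) = (\<Prod>i\<in>I. if Y i \<omega> \<in> T then 1 / 2 else 1)"
      by (intro prod.cong) (auto simp: W_def)
    also have "\<dots> = (\<Prod>i\<in>{i \<in> I. Y i \<omega> \<in> T}. 1 / 2)"
      using \<open>finite I\<close> by (simp add: prod.inter_filter[symmetric])
    finally show ?thesis by simp
  qed
  have int: "integrable M (\<lambda>\<omega>. \<Prod>i\<in>I. W i \<omega>)"
    by (rule indep_vars_integrable[OF \<open>finite I\<close> indepW intW])
  have "prob {\<omega> \<in> space M. card {i \<in> I. Y i \<omega> \<in> T} \<le> k}
      = prob {\<omega> \<in> space M. (1 / 2) ^ k \<le> (\<Prod>i\<in>I. W i \<omega>)}"
    unfolding prodW by (intro arg_cong[where f = prob] Collect_cong conj_cong refl) simp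
  also have "\<dots> \<le> expectation (\<lambda>\<omega>. \<Prod>i\<in>I. W i \<omega>) / (1 / 2) ^ k"
    by (intro integral_Markov_inequality_measure[OF int, where A = "{}"]) (auto simp: prodW)
  also have "expectation (\<lambda>\<omega>. \<Prod>i\<in>I. W i \<omega>) = (1 - q / 2) ^ card I"
    by (subst indep_vars_lebesgue_integral[OF \<open>finite I\<close> indepW intW]) (auto simp: expW)
  also have "(1 - q / 2) ^ card I \<le> exp (- (q / 2)) ^ card I"
  \<comment> \<open>Monotonicity of the power needs \<open>1 - q / 2\<close> to be nonnegative. That
    \<open>q\<close> is a probability is known only through an element of \<open>I\<close>, hence
    the separate empty case.\<close>
  proof (cases "I = {}")
    case False
    then have "q \<le> 1" using q by (metis all_not_in_conv prob_le_1)
    then show ?thesis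
      using exp_ge_add_one_self[of "- (q / 2)"] by (intro power_mono) auto
  qed simp
  also have "exp (- (q / 2)) ^ card I = exp (- (real (card I) * q / 2))"
    by (simp add: exp_of_nat_mult[symmetric])
  finally show ?thesis
    by (simp add: power_one_over divide_right_mono mult.commute)
qed

text \<open>Union bound over observations and ordered pairs of factors: independence gives
  \<open>q\<^sup>2\<close> for each pair of distinct factors, and a diagonal pair gives the empty
  event.\<close>

lemma (in prob_space) prob_two_large_le:
  fixes Z :: "nat \<Rightarrow> 'p::finite \<Rightarrow> 'a \<Rightarrow> real"
  assumes indep: "indep_vars (\<lambda>_. borel) (\<lambda>(i, j). Z i j) ({1..} \<times> UNIV)"
    and T[measurable]: "T \<in> sets borel"
    and q: "\<And>i j. i \<ge> 1 \<Longrightarrow> prob (Z i j -` T \<inter> space M) = q"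
  shows "prob {\<omega> \<in> space M. \<exists>i\<in>{1..n}. \<exists>j j'. j \<noteq> j' \<and> Z i j \<omega> \<in> T \<and> Z i j' \<omega> \<in> T}
           \<le> real n * (real CARD('p))\<^sup>2 * q\<^sup>2"
proof -
  have rv[measurable]: "random_variable borel (Z i j)" if "i \<ge> 1" for i j
    using indep that by (auto simp: indep_vars_def)
  let ?E = "\<lambda>(i, j, j'). {\<omega> \<in> space M. j \<noteq> j' \<and> Z i j \<omega> \<in> T \<and> Z i j' \<omega> \<in> T}"
  let ?J = "{1..n} \<times> (UNIV :: 'p set) \<times> (UNIV :: 'p set)"
  have "{\<omega> \<in> space M. \<exists>i\<in>{1..n}. \<exists>j j'. j \<noteq> j' \<and> Z i j \<omega> \<in> T \<and> Z i j' \<omega> \<in> T} = \<Union> (?E ` ?J)"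
    by (fastforce simp: Bex_def)
  also have "prob \<dots> \<le> (\<Sum>x\<in>?J. prob (?E x))"
    by (intro finite_measure_subadditive_finite) auto
  also have "\<dots> \<le> (\<Sum>x\<in>?J. q\<^sup>2)"
  proof (intro sum_mono)
    fix x assume "x \<in> ?J"
    then obtain i j j' where x: "x = (i, j, j')" "i \<ge> 1" by auto
    show "prob (?E x) \<le> q\<^sup>2"
    proof (cases "j = j'")
      case False
      have "?E x = (\<Inter>y\<in>{(i, j), (i, j')}. (case y of (i, j) \<Rightarrow> Z i j) -` T \<inter> space M)"
        using False x by auto
      also have "prob \<dots> = (\<Prod>y\<in>{(i, j), (i, j')}. prob ((case y of (i, j) \<Rightarrow> Z i j) -` T \<inter> space M))"
        using x by (intro indep_varsD[OF indep]) auto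
      also have "\<dots> = q\<^sup>2"
        using False x q by (simp add: power2_eq_square)
      finally show ?thesis by simp
    qed (simp add: x)
  qed
  also have "\<dots> = real n * (real CARD('p))\<^sup>2 * q\<^sup>2"
    by (simp add: card_cartesian_product power2_eq_square)
  finally show ?thesis .
qed

section \<open>Growth rates of the threshold and of the tail\<close>

lemma filterlim_mult_powr_at_top:
  fixes u :: "nat \<Rightarrow> real"
  assumes "\<alpha> > 0" and u_pos: "\<And>n. n \<ge> 1 \<Longrightarrow> u n > 0"
    and u_upper: "(\<lambda>n. real n powr (-1 / \<alpha>) * u n) \<longlonglongrightarrow> 0"
  shows "filterlim (\<lambda>n. real n * u n powr (-\<alpha>)) at_top sequentially"
proof -
  \<comment> \<open>The target is the power with exponent -\<alpha> of
    \<open>real n powr (-1 / \<alpha>) * u n\<close>. Positivity makes the latter tend to 0 from the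
    right, where this power blows up.\<close>
  have ev: "\<forall>\<^sub>F n in sequentially. real n powr (-1 / \<alpha>) * u n \<in> {0<..}"
    using eventually_ge_at_top[of 1] by eventually_elim (use u_pos in auto)
  have "filterlim (\<lambda>x::real. x powr (-\<alpha>)) at_top (at_right 0)"
    using \<open>\<alpha> > 0\<close> by real_asymp
  moreover have "filterlim (\<lambda>n. real n powr (-1 / \<alpha>) * u n) (at_right 0) sequentially"
    using tendsto_imp_filterlim_at_right[OF u_upper] ev by simp
  ultimately have "filterlim (\<lambda>n. (real n powr (-1 / \<alpha>) * u n) powr (-\<alpha>)) at_top sequentially"
    by (rule filterlim_compose)
  moreover have "\<forall>\<^sub>F n in sequentially.
      (real n powr (-1 / \<alpha>) * u n) powr (-\<alpha>) = real n * u n powr (-\<alpha>)"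
    using eventually_ge_at_top[of 1]
    by eventually_elim (use u_pos \<open>\<alpha> > 0\<close> in \<open>auto simp: powr_mult powr_powr less_imp_le\<close>)
  ultimately show ?thesis by (simp add: filterlim_cong)
qed

lemma eventually_powr_le:
  fixes u :: "nat \<Rightarrow> real"
  assumes "filterlim (\<lambda>n. real n powr (-b) * u n) at_top sequentially"
  shows "\<forall>\<^sub>F n in sequentially. real n powr b \<le> u n"
proof -
  from assms have "\<forall>\<^sub>F n in sequentially. 1 \<le> real n powr (-b) * u n"
    by (simp add: filterlim_at_top)
  then show ?thesis
    using eventually_ge_at_top[of 1]
    by eventually_elim (simp add: powr_minus field_simps)
qed

lemma filterlim_at_top_of_powr_lower:
  fixes u :: "nat \<Rightarrow> real"
  assumes "b > 0" and "filterlim (\<lambda>n. real n powr (-b) * u n) at_top sequentially"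
  shows "filterlim u at_top sequentially"
proof (rule filterlim_at_top_mono[OF _ eventually_powr_le[OF assms(2)]])
  show "filterlim (\<lambda>n. real n powr b) at_top sequentially"
    using \<open>b > 0\<close> by real_asymp
qed

text \<open>Eventually \<open>u n\<close> is at least \<open>real n powr b\<close>, which bounds the
  sequence by a power of n with the negative exponent \<open>1 - b * \<gamma>\<close>.\<close>

lemma tendsto_mult_powr_0:
  fixes u :: "nat \<Rightarrow> real"
  assumes "\<gamma> > 0" "1 < b * \<gamma>" and "filterlim (\<lambda>n. real n powr (-b) * u n) at_top sequentially"
  shows "(\<lambda>n. real n * u n powr (-\<gamma>)) \<longlonglongrightarrow> 0"
proof (rule tendsto_sandwich[OF _ _ tendsto_const])
  show "\<forall>\<^sub>F n in sequentially. real n * u n powr (-\<gamma>) \<le> real n powr (1 - b * \<gamma>)"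
    using eventually_powr_le[OF assms(3)] eventually_ge_at_top[of 1]
  proof eventually_elim
    case (elim n)
    then have "u n powr (-\<gamma>) \<le> (real n powr b) powr (-\<gamma>)"
      using \<open>\<gamma> > 0\<close> by (intro powr_mono2') auto
    then have "real n * u n powr (-\<gamma>) \<le> real n powr 1 * (real n powr b) powr (-\<gamma>)"
      using elim by (intro mult_mono) auto
    also have "\<dots> = real n powr (1 - b * \<gamma>)"
      by (simp only: powr_powr powr_add[symmetric]) simp
    finally show ?case .
  qed
  show "(\<lambda>n. real n powr (1 - b * \<gamma>)) \<longlonglongrightarrow> 0"
    using assms(2) by real_asymp
qed auto

lemma asymp_equiv_powr_bounds:
  fixes f :: "real \<Rightarrow> real"
  assumes "c > 0" and "f \<sim>[at_top] (\<lambda>z. c * z powr (-\<alpha>))"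
  shows "\<forall>\<^sub>F z in at_top. c / 2 * z powr (-\<alpha>) \<le> f z \<and> f z \<le> 2 * c * z powr (-\<alpha>)"
proof -
  have pos: "\<forall>\<^sub>F z in at_top. c * z powr (-\<alpha>) > 0"
    using eventually_gt_at_top[of 0] by eventually_elim (use \<open>c > 0\<close> in auto)
  then have lim: "((\<lambda>z. f z / (c * z powr (-\<alpha>))) \<longlongrightarrow> 1) at_top"
    by (intro asymp_equivD_strong[OF assms(2)]) (auto elim: eventually_mono)
  have "\<forall>\<^sub>F z in at_top. f z / (c * z powr (-\<alpha>)) > 1 / 2"
    by (rule order_tendstoD[OF lim]) simp
  moreover have "\<forall>\<^sub>F z in at_top. f z / (c * z powr (-\<alpha>)) < 2"
    by (rule order_tendstoD[OF lim]) simp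
  ultimately show ?thesis
    using pos by eventually_elim (simp add: field_simps)
qed

text \<open>The nonnegative and the symmetric case are reduced here to four common facts, so that
  the main argument runs without a case distinction. The factor 2 in the last one pays for the two
  tails of a symmetric law.\<close>

lemma sign_cases:
  fixes law :: "real measure"
  assumes "prob_space law" and [simp]: "sets law = sets borel"
    and cases: "((AE z in law. z \<ge> 0) \<and> S = {1}) \<or>
                (distr law borel uminus = law \<and> S = {1, -1})"
  shows "S \<subseteq> {1, -1}"
    and "AE z in law. \<exists>s\<in>S. s * z = \<bar>z\<bar>"
    and "s \<in> S \<Longrightarrow> measure law {z. s * z > x} = measure law {x<..}"
    and "x \<ge> 0 \<Longrightarrow> measure law {z. \<bar>z\<bar> > x} \<le> 2 * measure law {x<..}"
proof -
  interpret prob_space law by fact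
  have [simp]: "space law = UNIV" using sets_eq_imp_space_eq[of law borel] by simp
  have meas[measurable_cong]: "sets law = sets borel" by simp
  have reflect: "measure law {z. - z > x} = measure law {x<..}"
    if "distr law borel uminus = law" for x :: real
  proof -
    have "measure law {x<..} = measure (distr law borel uminus) {x<..}" by (simp add: that)
    also have "\<dots> = measure law {z. - z > x}"
      by (subst measure_distr) (auto intro!: arg_cong[where f = "measure law"])
    finally show ?thesis ..
  qed
  show "S \<subseteq> {1, -1}" using cases by auto
  show "AE z in law. \<exists>s\<in>S. s * z = \<bar>z\<bar>"
    using cases
  proof
    assume "distr law borel uminus = law \<and> S = {1, -1}"
    then show ?thesis by (auto simp: abs_if)
  qed auto
  show "measure law {z. s * z > x} = measure law {x<..}" if "s \<in> S"
    using cases that reflect[of x] by (auto simp: greaterThan_def)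
  show "measure law {z. \<bar>z\<bar> > x} \<le> 2 * measure law {x<..}" if "x \<ge> 0"
    using cases
  proof
    assume "(AE z in law. z \<ge> 0) \<and> S = {1}"
    then have "AE z in law. z \<ge> 0" ..
    then have "measure law {z. \<bar>z\<bar> > x} = measure law {x<..}"
      by (intro finite_measure_eq_AE) auto
    then show ?thesis by simp
  next
    assume *: "distr law borel uminus = law \<and> S = {1, -1}"
    have "{z. \<bar>z\<bar> > x} = {x<..} \<union> {z. - z > x}" by auto
    then have "measure law {z. \<bar>z\<bar> > x} \<le> measure law {x<..} + measure law {z. - z > x}"
      by (auto intro!: measure_Un_le)
    then show ?thesis using reflect[of x] * by simp
  qed
qed

section \<open>Vanishing probabilities of the exceptional events\<close>

lemma tendsto_exp_count_bound:
  fixes v q :: "nat \<Rightarrow> real" and k :: "nat \<Rightarrow> nat"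
  assumes v: "filterlim v at_top sequentially" and k: "(\<lambda>n. real (k n)) \<in> o(v)"
    and "b > 0" and q: "\<forall>\<^sub>F n in sequentially. b * v n \<le> real n * q n"
  shows "(\<lambda>n. 2 ^ k n * exp (- (real n * q n / 2))) \<longlonglongrightarrow> 0"
proof (rule tendsto_sandwich[OF _ _ tendsto_const])
  \<comment> \<open>The exponential supplies at least \<open>b / 2 * v n\<close> in the exponent.
    Spending \<open>b / 4 * v n\<close> on \<open>k n\<close>, with 2 replaced by e, leaves the same
    amount for the decay.\<close>
  have "\<forall>\<^sub>F n in sequentially. norm (real (k n)) \<le> b / 4 * norm (v n)"
    using k \<open>b > 0\<close> by (intro landau_o.smallD) auto
  moreover have "\<forall>\<^sub>F n in sequentially. v n \<ge> 0"
    using v by (simp add: filterlim_at_top)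
  ultimately show "\<forall>\<^sub>F n in sequentially.
      2 ^ k n * exp (- (real n * q n / 2)) \<le> exp (- (b / 4 * v n))"
    using q
  proof eventually_elim
    case (elim n)
    have "(2::real) ^ k n \<le> exp 1 ^ k n"
      using exp_ge_add_one_self[of 1] by (intro power_mono) auto
    also have "\<dots> = exp (real (k n))"
      by (simp add: exp_of_nat_mult[symmetric])
    finally have "2 ^ k n * exp (- (real n * q n / 2))
        \<le> exp (real (k n)) * exp (- (real n * q n / 2))"
      by (intro mult_right_mono) auto
    also have "\<dots> = exp (real (k n) - real n * q n / 2)"
      by (simp add: exp_add[symmetric])
    also have "\<dots> \<le> exp (- (b / 4 * v n))"
      using elim by (simp add: field_simps)
    finally show ?case .
  qed
  have "filterlim (\<lambda>n. b / 4 * v n) at_top sequentially"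
    using v \<open>b > 0\<close> by (intro filterlim_tendsto_pos_mult_at_top[OF tendsto_const]) auto
  then show "(\<lambda>n. exp (- (b / 4 * v n))) \<longlonglongrightarrow> 0"
    by (intro filterlim_compose[OF exp_at_bot]) (simp add: filterlim_uminus_at_bot)
qed auto

lemma (in prob_space) tendsto_prob_few_large:
  fixes Z :: "nat \<Rightarrow> 'p \<Rightarrow> 'a \<Rightarrow> real"
  assumes indep: "indep_vars (\<lambda>_. borel) (\<lambda>(i, j). Z i j) ({1..} \<times> UNIV)"
    and T[measurable]: "\<And>n. T n \<in> sets borel"
    and q: "\<And>n i j. i \<ge> 1 \<Longrightarrow> prob (Z i j -` T n \<inter> space M) = q n"
    and v: "filterlim v at_top sequentially" and k: "(\<lambda>n. real (k n)) \<in> o(v)"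
    and "b > 0" and qv: "\<forall>\<^sub>F n in sequentially. b * v n \<le> real n * q n"
  shows "(\<lambda>n. prob {\<omega> \<in> space M. card {i \<in> {1..n}. Z i j \<omega> \<in> T n} \<le> k n}) \<longlonglongrightarrow> 0"
proof (rule tendsto_sandwich[OF _ _ tendsto_const])
  \<comment> \<open>Independence is stated for the doubly indexed family, so the successes of factor
    \<open>j\<close> are counted over pairs whose second entry is \<open>j\<close>.\<close>
  have "card {x \<in> {1..n} \<times> {j}. (case x of (i, j) \<Rightarrow> Z i j) \<omega> \<in> T n}
      = card {i \<in> {1..n}. Z i j \<omega> \<in> T n}" for n \<omega>
  proof -
    have "{x \<in> {1..n} \<times> {j}. (case x of (i, j) \<Rightarrow> Z i j) \<omega> \<in> T n}
        = (\<lambda>i. (i, j)) ` {i \<in> {1..n}. Z i j \<omega> \<in> T n}"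
      by auto
    then show ?thesis by (simp add: card_image inj_on_def)
  qed
  moreover have "prob {\<omega> \<in> space M. card {x \<in> {1..n} \<times> {j}. (case x of (i, j) \<Rightarrow> Z i j) \<omega> \<in> T n} \<le> k n}
      \<le> 2 ^ k n * exp (- (real (card ({1..n} \<times> {j})) * q n / 2))" for n
    by (intro prob_card_le indep_vars_subset[OF indep]) (auto simp: q)
  ultimately show "\<forall>\<^sub>F n in sequentially. prob {\<omega> \<in> space M. card {i \<in> {1..n}. Z i j \<omega> \<in> T n} \<le> k n}
      \<le> 2 ^ k n * exp (- (real n * q n / 2))"
    by (simp add: card_cartesian_product)
qed (use tendsto_exp_count_bound[OF v k \<open>b > 0\<close> qv] in auto)

lemma (in prob_space) tendsto_prob_two_large:
  fixes Z :: "nat \<Rightarrow> 'p::finite \<Rightarrow> 'a \<Rightarrow> real"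
  assumes indep: "indep_vars (\<lambda>_. borel) (\<lambda>(i, j). Z i j) ({1..} \<times> UNIV)"
    and T[measurable]: "\<And>n. T n \<in> sets borel"
    and q: "\<And>n i j. i \<ge> 1 \<Longrightarrow> prob (Z i j -` T n \<inter> space M) = q n"
    and lim: "(\<lambda>n. real n * (q n)\<^sup>2) \<longlonglongrightarrow> 0"
  shows "(\<lambda>n. prob {\<omega> \<in> space M. \<exists>i\<in>{1..n}. \<exists>j j'. j \<noteq> j' \<and> Z i j \<omega> \<in> T n \<and> Z i j' \<omega> \<in> T n})
           \<longlonglongrightarrow> 0"
proof (rule tendsto_sandwich[OF _ _ tendsto_const])
  show "\<forall>\<^sub>F n in sequentially.
      prob {\<omega> \<in> space M. \<exists>i\<in>{1..n}. \<exists>j j'. j \<noteq> j' \<and> Z i j \<omega> \<in> T n \<and> Z i j' \<omega> \<in> T n}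
      \<le> (real CARD('p))\<^sup>2 * (real n * (q n)\<^sup>2)"
    using prob_two_large_le[OF indep T q] by (simp add: mult_ac)
  show "(\<lambda>n. (real CARD('p))\<^sup>2 * (real n * (q n)\<^sup>2)) \<longlonglongrightarrow> 0"
    using tendsto_mult_left[OF lim] by simp
qed auto

section \<open>Separation of the factor clusters with probability tending to one\<close>

theorem proposition5p1:
  fixes A :: "real ^ 'p::finite ^ 'd::finite"
    and M :: "'w measure"
    and Z :: "nat \<Rightarrow> 'p \<Rightarrow> 'w \<Rightarrow> real"
    and law :: "real measure"
    and S :: "real set"
    and \<alpha> c :: real
    and u :: "nat \<Rightarrow> real"
    and k :: "nat \<Rightarrow> nat"
  assumes A_nonneg: "\<And>m j. A $ m $ j \<ge> 0"
    and A_columns: "\<And>j. column j A \<noteq> 0"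
    and prob: "prob_space M"
    and indep: "prob_space.indep_vars M (\<lambda>_. borel) (\<lambda>(i, j). Z i j) ({1..} \<times> UNIV)"
    and ident: "\<And>i j. i \<ge> 1 \<Longrightarrow> distr M borel (Z i j) = law"
    and cases: "((AE z in law. z \<ge> 0) \<and> S = {1}) \<or>
                (distr law borel uminus = law \<and> S = {1, -1})"
    and \<alpha>_pos: "\<alpha> > 0"
    and c_pos: "c > 0"
    and tail: "(\<lambda>z. measure law {z<..}) \<sim>[at_top] (\<lambda>z. c * z powr (-\<alpha>))"
    and u_pos: "\<And>n. n \<ge> 1 \<Longrightarrow> u n > 0"
    and u_upper: "(\<lambda>n. real n powr (-1 / \<alpha>) * u n) \<longlonglongrightarrow> 0"
    and u_lower: "filterlim (\<lambda>n. real n powr (-(\<alpha> + 2) / (\<alpha> * (\<alpha> + 3))) * u n) at_top sequentially"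
    and k_pos: "\<And>n. n \<ge> 1 \<Longrightarrow> k n > 0"
    and k_small: "(\<lambda>n. real (k n)) \<in> o(\<lambda>n. real n * u n powr (-\<alpha>))"
  shows "\<exists>B :: nat \<Rightarrow> 'w set.
           (\<forall>n. B n \<in> sets M) \<and> (\<lambda>n. measure M (B n)) \<longlonglongrightarrow> 1 \<and>
           (\<forall>\<^sub>F n in sequentially. \<forall>\<omega> \<in> B n.
              \<forall>j\<^sub>1 j\<^sub>2. \<forall>s\<^sub>1 \<in> S. \<forall>s\<^sub>2 \<in> S. s\<^sub>1 *\<^sub>R cdir A j\<^sub>1 \<noteq> s\<^sub>2 *\<^sub>R cdir A j\<^sub>2 \<longrightarrow>
                (\<forall>i\<^sub>1 \<in> factor_extremes A Z u n j\<^sub>1 s\<^sub>1 \<omega>. \<forall>i\<^sub>2 \<in> factor_extremes A Z u n j\<^sub>2 s\<^sub>2 \<omega>.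
                   in_different_components (extremes A Z u n \<omega>)
                     (knn_edges (k n) (extremes A Z u n \<omega>) (sphere_point A Z \<omega>)) i\<^sub>1 i\<^sub>2 \<and>
                   in_different_components (extremes A Z u n \<omega>)
                     (mutual_knn_edges (k n) (extremes A Z u n \<omega>) (sphere_point A Z \<omega>)) i\<^sub>1 i\<^sub>2))"
proof -
  interpret prob_space M by fact
  have rv[measurable]: "random_variable borel (Z i j)" if "i \<ge> 1" for i j
    using indep that by (auto simp: indep_vars_def)
  \<comment> \<open>Any single variable identifies \<open>law\<close>; \<open>undefined\<close> just
    names some factor index.\<close>
  have law: "prob_space law" "sets law = sets borel"
    unfolding ident[of 1 undefined, OF order.refl, symmetric]
    by (auto intro: prob_space_distr rv)
  note S = sign_cases[OF law cases]
  have "finite S" using S(1) finite_subset by auto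
  have prob_law: "prob (Z i j -` T \<inter> space M) = measure law T"
    if "i \<ge> 1" "T \<in> sets borel" for i j T
    using ident[OF that(1), of j, symmetric] that rv by (simp add: measure_distr)

  define L where "L = (\<Sum>j\<in>UNIV. norm (column j A))"
  have "L > 0" unfolding L_def using A_columns by (intro sum_pos) auto
  have "astar A > 0" by (rule astar_pos[OF A_nonneg A_columns])
  obtain D where "D > 0" and D: "\<And>v w. v \<in> (\<lambda>(s, j). s *\<^sub>R cdir A j) ` (S \<times> UNIV) \<Longrightarrow>
      w \<in> (\<lambda>(s, j). s *\<^sub>R cdir A j) ` (S \<times> UNIV) \<Longrightarrow> v \<noteq> w \<Longrightarrow> D \<le> dist v w"
    using finite_separated[of "(\<lambda>(s, j). s *\<^sub>R cdir A j) ` (S \<times> UNIV)"] \<open>finite S\<close> by auto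
  \<comment> \<open>The three terms ensure, in this order, \<open>\<epsilon> * L \<le> 1\<close>,
    the comparison with \<open>astar A\<close>, and \<open>8 * \<epsilon> * L \<le> D / 2\<close>,
    hence strictly below the minimal distance \<open>D\<close> of distinct directions.\<close>
  define \<epsilon> where "\<epsilon> = min (1 / L) (min (1 / astar A) (D / (16 * L)))"
  \<comment> \<open>The sum dominates each of its terms, so that one \<open>K\<close> works for all
    columns.\<close>
  define K where "K = \<epsilon> + (\<Sum>j\<in>UNIV. 2 / norm (column j A))"
  have \<epsilon>: "0 < \<epsilon>" "\<epsilon> * L \<le> 1" "\<epsilon> \<le> 1 / astar A" "8 * \<epsilon> * L < D"
  proof -
    show "0 < \<epsilon>" "\<epsilon> \<le> 1 / astar A"
      using \<open>L > 0\<close> \<open>D > 0\<close> \<open>astar A > 0\<close> by (auto simp: \<epsilon>_def)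
    have "\<epsilon> \<le> 1 / L" "\<epsilon> \<le> D / (16 * L)"
      by (auto simp: \<epsilon>_def)
    then show "\<epsilon> * L \<le> 1" "8 * \<epsilon> * L < D"
      using \<open>L > 0\<close> \<open>D > 0\<close> by (simp_all add: field_simps)
  qed
  have K\<epsilon>: "\<epsilon> \<le> K" by (simp add: K_def sum_nonneg)
  have K: "2 \<le> K * norm (column j A)" for j
  proof -
    have "2 / norm (column j A) \<le> (\<Sum>j\<in>UNIV. 2 / norm (column j A))"
      by (rule member_le_sum) auto
    also have "\<dots> \<le> K" using \<epsilon>(1) by (simp add: K_def)
    finally show ?thesis using A_columns[of j] by (simp add: field_simps)
  qed
  have "K > 0" using K\<epsilon> \<epsilon> by simp

  define b where "b = (\<alpha> + 2) / (\<alpha> * (\<alpha> + 3))"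
  have "b > 0" using \<alpha>_pos by (simp add: b_def)
  \<comment> \<open>The assumed lower rate of \<open>u\<close> enters here: the quotient exceeds 1
    because 2 \<alpha> + 4 > \<alpha> + 3. This is what makes two large factors in one observation
    negligible.\<close>
  have "b * (2 * \<alpha>) = 2 * (\<alpha> + 2) / (\<alpha> + 3)" using \<alpha>_pos by (simp add: b_def)
  also have "\<dots> > 1" using \<alpha>_pos by (simp add: field_simps)
  finally have b2\<alpha>: "1 < b * (2 * \<alpha>)" .
  have u_lower': "filterlim (\<lambda>n. real n powr (-b) * u n) at_top sequentially"
    using u_lower by (simp only: b_def minus_divide_left)
  have u_top: "filterlim u at_top sequentially"
    by (rule filterlim_at_top_of_powr_lower[OF \<open>b > 0\<close> u_lower'])
  have v_top: "filterlim (\<lambda>n. real n * u n powr (-\<alpha>)) at_top sequentially"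
    by (rule filterlim_mult_powr_at_top[OF \<alpha>_pos u_pos u_upper])
  have tail_at: "\<forall>\<^sub>F n in sequentially.
      c / 2 * (x * u n) powr (-\<alpha>) \<le> measure law {x * u n<..} \<and>
      measure law {x * u n<..} \<le> 2 * c * (x * u n) powr (-\<alpha>)" if "x > 0" for x
    using asymp_equiv_powr_bounds[OF c_pos tail]
    by (rule eventually_compose_filterlim)
      (intro filterlim_tendsto_pos_mult_at_top[OF tendsto_const that u_top])

  define E1 where "E1 n = {\<omega> \<in> space M. \<exists>i\<in>{1..n}. \<exists>j j'. j \<noteq> j' \<and>
      Z i j \<omega> \<in> {z. \<bar>z\<bar> > \<epsilon> * u n} \<and> Z i j' \<omega> \<in> {z. \<bar>z\<bar> > \<epsilon> * u n}}" for n
  \<comment> \<open>In the nonnegative case the sign relation holds only almost surely, so its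
    failures are collected in a null event. In the symmetric case this event is empty.\<close>
  define E2 where "E2 n = {\<omega> \<in> space M. \<exists>i\<in>{1..n}. \<exists>j. \<forall>s\<in>S. s * Z i j \<omega> \<noteq> \<bar>Z i j \<omega>\<bar>}" for n
  define E3 where "E3 j s n = {\<omega> \<in> space M.
      card {i \<in> {1..n}. Z i j \<omega> \<in> {z. s * z > K * u n}} \<le> k n}" for j s n

  have meas: "E1 n \<in> events" "E2 n \<in> events" "E3 j s n \<in> events" for n j s
  proof -
    show "E1 n \<in> events" unfolding E1_def by (measurable; simp)
    show "E2 n \<in> events"
      unfolding E2_def using \<open>finite S\<close>
      by (intro sets.sets_Collect_finite_Ex sets.sets_Collect_countable_Ex sets.sets_Collect_finite_All) auto
    \<comment> \<open>Writing the count as a sum of measurable functions makes its measurability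
      visible.\<close>
    have "card {i \<in> {1..n}. Z i j \<omega> \<in> {z. s * z > K * u n}}
        = (\<Sum>i\<in>{1..n}. if s * Z i j \<omega> > K * u n then 1 else 0)" for \<omega>
      by (simp add: sum.If_cases Int_def)
    then show "E3 j s n \<in> events" unfolding E3_def by simp
  qed

  have E1: "(\<lambda>n. prob (E1 n)) \<longlonglongrightarrow> 0"
    unfolding E1_def
  proof (rule tendsto_prob_two_large[OF indep])
    show "prob (Z i j -` {z. \<bar>z\<bar> > \<epsilon> * u n} \<inter> space M) = measure law {z. \<bar>z\<bar> > \<epsilon> * u n}"
      if "i \<ge> 1" for n i j using that by (intro prob_law) auto
    show "(\<lambda>n. real n * (measure law {z. \<bar>z\<bar> > \<epsilon> * u n})\<^sup>2) \<longlonglongrightarrow> 0"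
    proof (rule tendsto_sandwich[OF _ _ tendsto_const])
      \<comment> \<open>The 4 combines the factor 2 for both tails with the factor 2 in the upper
        bound of \<open>tail_at\<close>.\<close>
      let ?C = "(4 * c * \<epsilon> powr (-\<alpha>))\<^sup>2"
      show "\<forall>\<^sub>F n in sequentially. real n * (measure law {z. \<bar>z\<bar> > \<epsilon> * u n})\<^sup>2
          \<le> ?C * (real n * u n powr (- (2 * \<alpha>)))"
        using tail_at[OF \<epsilon>(1)] eventually_ge_at_top[of 1]
      proof eventually_elim
        case (elim n)
        then have "u n > 0" using u_pos by simp
        then have "measure law {z. \<bar>z\<bar> > \<epsilon> * u n} \<le> 2 * measure law {\<epsilon> * u n<..}"
          using \<epsilon>(1) by (intro S(4)) simp
        also have "\<dots> \<le> 4 * c * (\<epsilon> * u n) powr (-\<alpha>)" using elim by simp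
        also have "\<dots> = 4 * c * \<epsilon> powr (-\<alpha>) * u n powr (-\<alpha>)"
          using \<open>u n > 0\<close> \<epsilon>(1) by (simp add: powr_mult)
        finally have "(measure law {z. \<bar>z\<bar> > \<epsilon> * u n})\<^sup>2 \<le> (4 * c * \<epsilon> powr (-\<alpha>) * u n powr (-\<alpha>))\<^sup>2"
          by (intro power_mono) auto
        also have "\<dots> = ?C * u n powr (- (2 * \<alpha>))"
          using powr_add[of "u n" "-\<alpha>" "-\<alpha>"]
          by (simp add: power_mult_distrib power2_eq_square[of "u n powr (-\<alpha>)"])
        finally have "(measure law {z. \<bar>z\<bar> > \<epsilon> * u n})\<^sup>2 \<le> ?C * u n powr (- (2 * \<alpha>))" .
        from mult_left_mono[OF this, of "real n"] show ?case by (simp add: mult_ac)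
      qed
      show "(\<lambda>n. ?C * (real n * u n powr (- (2 * \<alpha>)))) \<longlonglongrightarrow> 0"
        using tendsto_mult_left[OF tendsto_mult_powr_0[OF _ b2\<alpha> u_lower'], of ?C] \<alpha>_pos by simp
    qed auto
  qed measurable

  have E2: "prob (E2 n) = 0" for n
  proof -
    have "AE \<omega> in M. \<exists>s\<in>S. s * Z i j \<omega> = \<bar>Z i j \<omega>\<bar>" if "i \<ge> 1" for i j
      using S(2) ident[OF that, of j, symmetric] rv[OF that] by (auto dest!: AE_distrD)
    then have "AE \<omega> in M. \<forall>i\<in>{1..n}. \<forall>j\<in>UNIV. \<exists>s\<in>S. s * Z i j \<omega> = \<bar>Z i j \<omega>\<bar>"
      by (intro AE_finite_allI) auto
    then show ?thesis
      unfolding E2_def using meas(2)[of n] by (subst prob_Collect_eq_0) (auto simp: E2_def)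
  qed

  have E3: "(\<lambda>n. prob (E3 j s n)) \<longlonglongrightarrow> 0" if "s \<in> S" for j s
    unfolding E3_def
  proof (rule tendsto_prob_few_large[OF indep _ _ v_top k_small])
    show "prob (Z i j -` {z. s * z > K * u n} \<inter> space M) = measure law {K * u n<..}"
      if "i \<ge> 1" for n i j
      using that S(3)[OF \<open>s \<in> S\<close>, of "K * u n"] by (subst prob_law) auto
    show "0 < c / 2 * K powr (-\<alpha>)" using c_pos \<open>K > 0\<close> by simp
    show "\<forall>\<^sub>F n in sequentially. c / 2 * K powr (-\<alpha>) * (real n * u n powr (-\<alpha>))
        \<le> real n * measure law {K * u n<..}"
      using tail_at[OF \<open>K > 0\<close>] eventually_ge_at_top[of 1]
    proof eventually_elim
      case (elim n)
      then have "c / 2 * K powr (-\<alpha>) * u n powr (-\<alpha>) \<le> measure law {K * u n<..}"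
        using \<open>K > 0\<close> u_pos[of n] by (simp add: powr_mult)
      from mult_left_mono[OF this, of "real n"] show ?case by (simp add: mult_ac)
    qed
  qed measurable

  \<comment> \<open>There are finitely many signed factor indices, so the union bound is a finite
    sum of sequences tending to 0.\<close>
  define Bad where "Bad n = E1 n \<union> E2 n \<union> (\<Union>(j, s)\<in>UNIV \<times> S. E3 j s n)" for n
  have Bad_meas: "Bad n \<in> events" for n
    unfolding Bad_def using meas \<open>finite S\<close> by (intro sets.Un sets.finite_UN) auto
  have Bad_lim: "(\<lambda>n. prob (Bad n)) \<longlonglongrightarrow> 0"
  proof (rule tendsto_sandwich[OF _ _ tendsto_const])
    let ?J = "(UNIV :: 'p set) \<times> S"
    have "prob (Bad n) \<le> prob (E1 n) + prob (E2 n) + (\<Sum>(j, s)\<in>?J. prob (E3 j s n))" for n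
    proof -
      have "prob (\<Union>(j, s)\<in>?J. E3 j s n) \<le> (\<Sum>x\<in>?J. prob (case x of (j, s) \<Rightarrow> E3 j s n))"
        using meas \<open>finite S\<close> by (intro finite_measure_subadditive_finite) auto
      also have "\<dots> = (\<Sum>(j, s)\<in>?J. prob (E3 j s n))"
        by (intro sum.cong) auto
      finally show ?thesis
        unfolding Bad_def
        using measure_Un_le[of "E1 n \<union> E2 n" M "\<Union>(j, s)\<in>?J. E3 j s n"]
          measure_Un_le[of "E1 n" M "E2 n"] meas \<open>finite S\<close>
        by (force intro!: sets.finite_UN)
    qed
    then show "\<forall>\<^sub>F n in sequentially.
        prob (Bad n) \<le> prob (E1 n) + prob (E2 n) + (\<Sum>(j, s)\<in>?J. prob (E3 j s n))"
      by simp
    have "(\<lambda>n. \<Sum>x\<in>?J. prob (E3 (fst x) (snd x) n)) \<longlonglongrightarrow> (\<Sum>x\<in>?J. 0)"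
      by (intro tendsto_sum E3) auto
    with tendsto_add[OF E1 this]
    show "(\<lambda>n. prob (E1 n) + prob (E2 n) + (\<Sum>(j, s)\<in>?J. prob (E3 j s n))) \<longlonglongrightarrow> 0"
      by (simp add: E2 case_prod_beta)
  qed auto

  show ?thesis
  proof (intro exI[of _ "\<lambda>n. space M - Bad n"] conjI)
    show "\<forall>n. space M - Bad n \<in> events" using Bad_meas by auto
    show "(\<lambda>n. prob (space M - Bad n)) \<longlonglongrightarrow> 1"
      using tendsto_diff[OF tendsto_const Bad_lim, of 1] Bad_meas by (simp add: prob_compl)
    show "\<forall>\<^sub>F n in sequentially. \<forall>\<omega>\<in>space M - Bad n.
      \<forall>j\<^sub>1 j\<^sub>2. \<forall>s\<^sub>1 \<in> S. \<forall>s\<^sub>2 \<in> S. s\<^sub>1 *\<^sub>R cdir A j\<^sub>1 \<noteq> s\<^sub>2 *\<^sub>R cdir A j\<^sub>2 \<longrightarrow>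
        (\<forall>i\<^sub>1 \<in> factor_extremes A Z u n j\<^sub>1 s\<^sub>1 \<omega>. \<forall>i\<^sub>2 \<in> factor_extremes A Z u n j\<^sub>2 s\<^sub>2 \<omega>.
           in_different_components (extremes A Z u n \<omega>)
             (knn_edges (k n) (extremes A Z u n \<omega>) (sphere_point A Z \<omega>)) i\<^sub>1 i\<^sub>2 \<and>
           in_different_components (extremes A Z u n \<omega>)
             (mutual_knn_edges (k n) (extremes A Z u n \<omega>) (sphere_point A Z \<omega>)) i\<^sub>1 i\<^sub>2)"
      \<comment> \<open>Outside \<open>Bad n\<close> the deterministic lemma applies for each n
        \<ge> 1, where \<open>u n\<close> is positive; the asymptotics concern only the probability
        of \<open>Bad n\<close>.\<close>
      using eventually_ge_at_top[of 1]
    proof (eventually_elim, intro ballI allI impI)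
      fix n :: nat and \<omega> j\<^sub>1 j\<^sub>2 s\<^sub>1 s\<^sub>2 i\<^sub>1 i\<^sub>2
      assume "1 \<le> n" and \<omega>: "\<omega> \<in> space M - Bad n"
        and fe: "s\<^sub>1 \<in> S" "s\<^sub>2 \<in> S" "s\<^sub>1 *\<^sub>R cdir A j\<^sub>1 \<noteq> s\<^sub>2 *\<^sub>R cdir A j\<^sub>2"
          "i\<^sub>1 \<in> factor_extremes A Z u n j\<^sub>1 s\<^sub>1 \<omega>" "i\<^sub>2 \<in> factor_extremes A Z u n j\<^sub>2 s\<^sub>2 \<omega>"
      from \<omega> have nE: "\<omega> \<in> space M" "\<omega> \<notin> E1 n" "\<omega> \<notin> E2 n"
        and nE3: "\<And>j s. s \<in> S \<Longrightarrow> \<omega> \<notin> E3 j s n"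
        by (auto simp: Bad_def)
      have single: "\<bar>Z i j \<omega>\<bar> \<le> \<epsilon> * u n \<or> \<bar>Z i j' \<omega>\<bar> \<le> \<epsilon> * u n"
        if "i \<in> {1..n}" "j \<noteq> j'" for i j j'
        using nE that unfolding E1_def by force
      have sign: "\<exists>s\<in>S. s * Z i j \<omega> = \<bar>Z i j \<omega>\<bar>" if "i \<in> {1..n}" for i j
        using nE that unfolding E2_def by blast
      have large: "k n < card {i \<in> {1..n}. s * Z i j \<omega> > K * u n}" if "s \<in> S" for j s
        using nE3[OF that, of j] nE(1) by (simp add: E3_def)
      have apart: "8 * \<epsilon> * (\<Sum>j\<in>UNIV. norm (column j A)) < dist (s *\<^sub>R cdir A j) (s' *\<^sub>R cdir A j')"
        if "s \<in> S" "s' \<in> S" "s *\<^sub>R cdir A j \<noteq> s' *\<^sub>R cdir A j'" for j s j' s'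
      proof -
        have "D \<le> dist (s *\<^sub>R cdir A j) (s' *\<^sub>R cdir A j')"
          using that by (intro D) auto
        with \<epsilon>(4) show ?thesis by (simp add: L_def)
      qed
      note c = factor_clusters_in_different_components[where A = A and Z = Z and \<omega> = \<omega> and K = K,
          OF A_columns S(1) u_pos[OF \<open>1 \<le> n\<close>] \<epsilon>(1) \<epsilon>(2)[unfolded L_def] \<epsilon>(3) K\<epsilon> K apart single sign large fe]
      show "in_different_components (extremes A Z u n \<omega>)
             (knn_edges (k n) (extremes A Z u n \<omega>) (sphere_point A Z \<omega>)) i\<^sub>1 i\<^sub>2 \<and>
           in_different_components (extremes A Z u n \<omega>)
             (mutual_knn_edges (k n) (extremes A Z u n \<omega>) (sphere_point A Z \<omega>)) i\<^sub>1 i\<^sub>2"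
        using c by blast
    qed
  qed
qed

end
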